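(* Let $k,m\in\mathbb{N}$ and $p\in(0,2]$, and let $R_1=R_{k,m}^p$ be the unique root in $(0,1)$ of the equation $\Psi_1(r)=0$, where $$\Psi_1(r)=\frac{r^k}{1-r^k}+\frac{r^m}{1-r^m}-\frac p2 .$$ Let $f\in\mathcal{B}$ have the expansion $f(z)=\sum_{j=0}^\infty a_jz^j$ with $a=|f(0)|<1$, and let $\omega_n\in\mathcal{B}_n$ for $n\ge 1$. Then $$A_f(z):=a^p+B_1(f,|\omega_k(z)|)+A(f_0,|\omega_k(z)|)+|f(\omega_m(z))-a_0|\le 1\qquad\text{for } |z|=r\le R_1 .$$ The number $R_1$ cannot be improved: for every $R\in(R_1,1)$ there exist such $f$ and $\omega_n$ ($n\geq 1$) and a point $z$ with $|z|\le R$ such that $A_f(z)>1$.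
   Context: $\mathbb{N}=\{1,2,\dots\}$ and $\mathbb{D}=\{z\in\mathbb{C}:|z|<1\}$. $\mathcal{B}$ is the class of analytic functions $f$ on $\mathbb{D}$ with $\sup_{z\in\mathbb{D}}|f(z)|\le 1$. For $n\in\mathbb{N}$, $\mathcal{B}_n=\{\omega\in\mathcal{B}:\omega(0)=\cdots=\omega^{(n-1)}(0)=0,\ \omega^{(n)}(0)\ne0\}$. For $f(z)=\sum_{n\ge0}a_nz^n\in\mathcal{B}$, $f_0(z)=f(z)-f(0)$ and $0\le\rho<1$, put $$B_1(f,\rho)=\sum_{n=1}^\infty|a_n|\rho^n,\qquad A(f_0,\rho)=\Big(\frac1{1+|a_0|}+\frac{\rho}{1-\rho}\Big)\sum_{n=1}^\infty|a_n|^2\rho^{2n}.$$ *)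

theory Defs
  imports "HOL-Complex_Analysis.Complex_Analysis"
begin

definition schur_class :: "(complex \<Rightarrow> complex) set" where
  "schur_class = {f. f holomorphic_on ball 0 1 \<and> (\<forall>z\<in>ball 0 1. cmod (f z) \<le> 1)}"

definition schur_class_ord :: "nat \<Rightarrow> (complex \<Rightarrow> complex) set" where
  "schur_class_ord n =
     {w \<in> schur_class. (\<forall>j<n. (deriv ^^ j) w 0 = 0) \<and> (deriv ^^ n) w 0 \<noteq> 0}"

definition tcoeff :: "(complex \<Rightarrow> complex) \<Rightarrow> nat \<Rightarrow> complex" where
  "tcoeff f n = fps_nth (fps_expansion f 0) n"

lemma tcoeff_sums:
  assumes "f \<in> schur_class" "z \<in> ball 0 1"
  shows "(\<lambda>n. tcoeff f n * z ^ n) sums f z"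
  using holomorphic_power_series[of f 0 1 z] assms
  by (simp add: schur_class_def tcoeff_def fps_expansion_def)

lemma tcoeff_0: "tcoeff f 0 = f 0"
  by (simp add: tcoeff_def fps_expansion_def)

text \<open>The series start at index 1, hence the shift by \<open>Suc\<close>. For \<open>f\<close> in the class and
  \<open>0 \<le> \<rho> < 1\<close> they converge.\<close>

definition B1 :: "(complex \<Rightarrow> complex) \<Rightarrow> real \<Rightarrow> real" where
  "B1 f \<rho> = (\<Sum>n. cmod (tcoeff f (Suc n)) * \<rho> ^ Suc n)"

text \<open>The quantity \<open>A(f\<^sub>0, \<rho>)\<close> for \<open>f\<^sub>0 = f - f 0\<close>. It also involves \<open>\<bar>f 0\<bar>\<close>, which
  \<open>f\<^sub>0\<close> does not determine, so it is a function of \<open>f\<close>.\<close>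

definition A0 :: "(complex \<Rightarrow> complex) \<Rightarrow> real \<Rightarrow> real" where
  "A0 f \<rho> = (1 / (1 + cmod (tcoeff f 0)) + \<rho> / (1 - \<rho>)) *
             (\<Sum>n. (cmod (tcoeff f (Suc n)))\<^sup>2 * \<rho> ^ (2 * Suc n))"

definition Psi1 :: "nat \<Rightarrow> nat \<Rightarrow> real \<Rightarrow> real \<Rightarrow> real" where
  "Psi1 k m p r = r ^ k / (1 - r ^ k) + r ^ m / (1 - r ^ m) - p / 2"

definition R1 :: "nat \<Rightarrow> nat \<Rightarrow> real \<Rightarrow> real" where
  "R1 k m p = (THE r. r \<in> {0<..<1} \<and> Psi1 k m p r = 0)"

definition bohr_sum ::
  "nat \<Rightarrow> nat \<Rightarrow> real \<Rightarrow> (complex \<Rightarrow> complex) \<Rightarrow> (nat \<Rightarrow> complex \<Rightarrow> complex) \<Rightarrow> complex \<Rightarrow> real" where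
  "bohr_sum k m p f \<omega> z =
     cmod (f 0) powr p + B1 f (cmod (\<omega> k z)) + A0 f (cmod (\<omega> k z))
     + cmod (f (\<omega> m z) - tcoeff f 0)"

end

theory Submission
  imports Defs
begin

text \<open>Multiplication by a function \<open>f = \<Sum>a\<^sub>n z\<^sup>n\<close> bounded by 1 is a contraction in the \<open>H\<^sup>2\<close> norm.
  Testing this on suitable vectors gives Carlson's inequalities, which bound \<open>\<bar>a\<^sub>2\<^sub>n\<^sub>+\<^sub>1\<bar>\<close> and
  \<open>\<bar>a\<^sub>2\<^sub>n\<bar>\<close> by \<open>1 - \<bar>a\<^sub>0\<bar>\<^sup>2 - \<dots> - \<bar>a\<^sub>n\<bar>\<^sup>2\<close>, with the last square divided by \<open>1 + \<bar>a\<^sub>0\<bar>\<close>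
  in the even case. Summing them in pairs against \<open>\<rho>\<^sup>n\<close> yields
  \<open>B\<^sub>1(f, \<rho>) + A(f\<^sub>0, \<rho>) \<le> (1 - a\<^sup>2) \<rho> / (1 - \<rho>)\<close>. By the Schwarz lemma
  \<open>\<bar>\<omega>\<^sub>n(z)\<bar> \<le> r\<^sup>n\<close>, so the sum is at most \<open>a\<^sup>p + (1 - a\<^sup>2) p/2 \<le> 1\<close> at \<open>r \<le> R\<^sub>1\<close>.
  For sharpness take \<open>f(z) = (z - a)/(1 - a z)\<close>, \<open>\<omega>\<^sub>n(z) = z\<^sup>n\<close> and \<open>z = R\<close>: dropping
  \<open>A(f\<^sub>0, \<rho>)\<close> leaves a lower bound that equals 1 at \<open>a = 1\<close> and has derivative
  \<open>-2 \<Psi>\<^sub>1(R) < 0\<close> there.\<close>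

section \<open>Discrete Parseval identity and the Toeplitz contraction\<close>

lemma sum_powers_roots_unity:
  fixes N i l :: nat
  assumes "i < N" "l < N"
  defines "w \<equiv> cis (2 * pi / real N)"
  shows "(\<Sum>j<N. (w ^ i * cnj (w ^ l)) ^ j) = (if i = l then of_nat N else 0)"
proof -
  have w: "w ^ n = cis (2 * pi * real n / real N)" for n
    by (simp add: w_def Complex.DeMoivre mult_ac)
  have unit: "w ^ n * cnj (w ^ n) = 1" for n
    by (simp add: w cis_cnj cis_mult)
  show ?thesis
  proof (cases "i = l")
    case True
    then show ?thesis by (simp only: unit) simp
  next
    case False
    let ?v = "w ^ i * cnj (w ^ l)"
    have "N > 0" using assms by simp
    have "inj_on (\<lambda>k. w ^ k) {..<N}"
      using Complex.bij_betw_roots_unity[OF \<open>N > 0\<close>] by (simp add: w bij_betw_def)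
    then have "w ^ i \<noteq> w ^ l"
      using False assms by (auto dest: inj_onD)
    have "?v \<noteq> 1"
    proof
      assume "?v = 1"
      then have "w ^ i * (w ^ l * cnj (w ^ l)) = w ^ l"
        by (simp add: algebra_simps)
      with unit \<open>w ^ i \<noteq> w ^ l\<close> show False by simp
    qed
    moreover have "w ^ N = 1"
      using \<open>N > 0\<close> by (simp add: w)
    then have "?v ^ N = 1"
      by (metis complex_cnj_one complex_cnj_power mult_1 power_commutes power_mult
          power_mult_distrib power_one mult.commute)
    ultimately show ?thesis
      using False by (simp add: geometric_sum)
  qed
qed

text \<open>A finite stand-in for integrating over the circle of radius \<open>s\<close>: after
  expanding the square into a double sum, orthogonality of the N-th roots of unity removes the
  off-diagonal terms. Since the degree is below \<open>N\<close>, distinct exponents stay distinct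
  modulo \<open>N\<close>.\<close>

lemma parseval_roots_unity:
  fixes P :: "complex poly" and s :: real
  assumes "degree P < N"
  shows "(\<Sum>j<N. (cmod (poly P (of_real s * cis (2 * pi / real N) ^ j)))\<^sup>2)
         = real N * (\<Sum>i<N. (cmod (coeff P i))\<^sup>2 * s ^ (2 * i))"
proof -
  define w where "w = cis (2 * pi / real N)"
  define c where "c = (\<lambda>i. coeff P i * of_real s ^ i)"
  have val: "poly P (of_real s * w ^ j) = (\<Sum>i<N. c i * (w ^ i) ^ j)" for j
  proof -
    have "poly P (of_real s * w ^ j) = (\<Sum>i\<le>degree P. coeff P i * (of_real s * w ^ j) ^ i)"
      by (rule poly_altdef)
    also have "\<dots> = (\<Sum>i<N. coeff P i * (of_real s * w ^ j) ^ i)"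
      using assms by (intro sum.mono_neutral_left) (auto simp: coeff_eq_0)
    finally show ?thesis
      by (simp add: c_def power_mult_distrib mult_ac flip: power_mult)
  qed
  have "complex_of_real (\<Sum>j<N. (cmod (poly P (of_real s * w ^ j)))\<^sup>2)
        = (\<Sum>j<N. \<Sum>i<N. \<Sum>l<N. c i * cnj (c l) * (w ^ i * cnj (w ^ l)) ^ j)"
    unfolding of_real_sum val complex_norm_square cnj_sum sum_product
    by (intro sum.cong refl) (simp add: power_mult_distrib mult_ac)
  also have "\<dots> = (\<Sum>i<N. \<Sum>j<N. \<Sum>l<N. c i * cnj (c l) * (w ^ i * cnj (w ^ l)) ^ j)"
    by (rule sum.swap)
  also have "\<dots> = (\<Sum>i<N. \<Sum>l<N. \<Sum>j<N. c i * cnj (c l) * (w ^ i * cnj (w ^ l)) ^ j)"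
    by (intro sum.cong refl sum.swap)
  also have "\<dots> = (\<Sum>i<N. \<Sum>l<N. c i * cnj (c l) * (if i = l then of_nat N else 0))"
    unfolding sum_distrib_left[symmetric] w_def
    by (intro sum.cong refl arg_cong2[where f = "(*)"] sum_powers_roots_unity) auto
  also have "\<dots> = (\<Sum>i<N. of_nat N * (c i * cnj (c i)))"
    by (intro sum.cong refl) (simp add: if_distrib[where f = "\<lambda>x. _ * x"] cong: if_cong)
  also have "\<dots> = complex_of_real (real N * (\<Sum>i<N. (cmod (c i))\<^sup>2))"
    by (simp add: sum_distrib_left complex_norm_square del: of_real_power)
  finally have "(\<Sum>j<N. (cmod (poly P (of_real s * w ^ j)))\<^sup>2)
      = real N * (\<Sum>i<N. (cmod (c i))\<^sup>2)"
    by (simp only: of_real_eq_iff)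
  then show ?thesis
    by (simp add: c_def w_def norm_mult norm_power power_mult_distrib power_even_abs
        flip: power_mult, simp add: mult.commute)
qed

lemma schur_conv_radius:
  assumes "f \<in> schur_class"
  shows "conv_radius (tcoeff f) \<ge> 1"
proof -
  have "f holomorphic_on eball 0 1"
    using assms by (simp add: schur_class_def one_ereal_def)
  from conv_radius_fps_expansion[OF this] show ?thesis
    by (simp add: fps_conv_radius_def tcoeff_def[abs_def])
qed

text \<open>A partial sum of \<open>f\<close> may exceed 1 in modulus, but uniform convergence on a
  smaller disc makes the excess arbitrarily small. This lets a polynomial replace \<open>f\<close>
  in the contraction argument.\<close>

lemma schur_partial_sums_bound:
  assumes f: "f \<in> schur_class" and "s < 1" "e > 0"
  shows "eventually (\<lambda>n. \<forall>z. cmod z \<le> s \<longrightarrow> cmod (\<Sum>i<n. tcoeff f i * z ^ i) \<le> 1 + e) sequentially"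
proof -
  have "ereal s < conv_radius (tcoeff f)"
    using \<open>s < 1\<close> schur_conv_radius[OF f] by (metis ereal_less(3) less_le_trans)
  from powser_uniform_limit[OF this, of 0]
  have "eventually (\<lambda>n. \<forall>z\<in>cball 0 s. dist (\<Sum>i<n. tcoeff f i * z ^ i) (\<Sum>i. tcoeff f i * z ^ i) < e)
      sequentially"
    using \<open>e > 0\<close> by (simp add: uniform_limit_iff)
  then show ?thesis
  proof eventually_elim
    case (elim n)
    show ?case
    proof (intro allI impI)
      fix z :: complex assume z: "cmod z \<le> s"
      then have zb: "z \<in> ball 0 1" using \<open>s < 1\<close> by simp
      have "dist (\<Sum>i<n. tcoeff f i * z ^ i) (f z) < e"
        using elim z sums_unique[OF tcoeff_sums[OF f zb]] by simp
      moreover have "cmod (f z) \<le> 1"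
        using f zb by (auto simp: schur_class_def)
      ultimately show "cmod (\<Sum>i<n. tcoeff f i * z ^ i) \<le> 1 + e"
        unfolding dist_norm by norm
    qed
  qed
qed

text \<open>The inner sums are the first coefficients of the product of \<open>f\<close> with the
  polynomial whose coefficients are \<open>x\<close>. With \<open>f\<close> replaced by a partial
  sum, Parseval on the circle of radius \<open>s\<close> compares the norms up to the factor
  \<open>(1 + e)\<^sup>2\<close>; then e tends to 0 for fixed s, and finally s tends to 1.\<close>

lemma toeplitz_contraction:
  assumes f: "f \<in> schur_class"
  shows "(\<Sum>i\<le>N. (cmod (\<Sum>j\<le>i. x j * tcoeff f (i - j)))\<^sup>2) \<le> (\<Sum>j\<le>N. (cmod (x j))\<^sup>2)"
    (is "(\<Sum>i\<le>N. ?d i) \<le> ?X")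
proof -
  have approx: "(\<Sum>i\<le>N. ?d i * s ^ (2 * i)) \<le> (1 + e)\<^sup>2 * ?X"
    if s: "0 < s" "s < 1" and "e > 0" for s e :: real
  proof -
    from eventually_conj[OF schur_partial_sums_bound[OF f \<open>s < 1\<close> \<open>e > 0\<close>] eventually_gt_at_top[of N]]
    obtain n where n: "\<And>z. cmod z \<le> s \<Longrightarrow> cmod (\<Sum>i<n. tcoeff f i * z ^ i) \<le> 1 + e" "n > N"
      by (auto simp: eventually_sequentially)
    define g where "g = (\<Sum>j\<le>N. monom (x j) j)"
    define q where "q = (\<Sum>i<n. monom (tcoeff f i) i)"
    have cg: "coeff g j = (if j \<le> N then x j else 0)" for j
      by (simp add: g_def coeff_sum if_distrib cong: if_cong)
    have cq: "coeff q j = (if j < n then tcoeff f j else 0)" for j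
      by (simp add: q_def coeff_sum if_distrib cong: if_cong)
    have pq: "cmod (poly q z) \<le> 1 + e" if "cmod z \<le> s" for z
      using n(1)[OF that] by (simp add: q_def poly_sum poly_monom)
    \<comment> \<open>Large enough for Parseval to apply to both \<open>g * q\<close> and
      \<open>g\<close> at the same nodes, and for the sums below \<open>M\<close> to contain all
      indices up to \<open>N\<close>.\<close>
    define M where "M = Suc (degree (g * q) + degree g + N)"
    define w where "w = (\<lambda>j. of_real s * cis (2 * pi / real M) ^ j)"
    have nw: "cmod (w j) \<le> s" for j
      using s by (simp add: w_def norm_mult norm_power)
    have "(\<Sum>i<M. (cmod (coeff g i))\<^sup>2 * s ^ (2 * i)) = (\<Sum>i\<le>N. (cmod (coeff g i))\<^sup>2 * s ^ (2 * i))"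
      by (rule sum.mono_neutral_right) (auto simp: M_def cg)
    also have "\<dots> \<le> ?X"
      using s by (intro sum_mono) (auto simp: cg power_le_one mult_left_le)
    finally have gX: "(\<Sum>i<M. (cmod (coeff g i))\<^sup>2 * s ^ (2 * i)) \<le> ?X" .
    \<comment> \<open>As \<open>n > N\<close>, truncating \<open>f\<close> to \<open>q\<close>
      leaves the product's coefficients up to \<open>N\<close> unchanged.\<close>
    have "(\<Sum>i\<le>N. ?d i * s ^ (2 * i)) = (\<Sum>i\<le>N. (cmod (coeff (g * q) i))\<^sup>2 * s ^ (2 * i))"
    proof (intro sum.cong refl)
      fix i assume "i \<in> {..N}"
      then have "coeff (g * q) i = (\<Sum>j\<le>i. x j * tcoeff f (i - j))"
        unfolding coeff_mult using n(2) by (intro sum.cong refl) (auto simp: cg cq)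
      then show "?d i * s ^ (2 * i) = (cmod (coeff (g * q) i))\<^sup>2 * s ^ (2 * i)"
        by simp
    qed
    also have "\<dots> \<le> (\<Sum>i<M. (cmod (coeff (g * q) i))\<^sup>2 * s ^ (2 * i))"
      using s by (intro sum_mono2) (auto simp: M_def)
    finally have "real M * (\<Sum>i\<le>N. ?d i * s ^ (2 * i)) \<le> (\<Sum>j<M. (cmod (poly (g * q) (w j)))\<^sup>2)"
      unfolding w_def by (subst parseval_roots_unity) (auto simp: M_def)
    also have "\<dots> \<le> (\<Sum>j<M. (1 + e)\<^sup>2 * (cmod (poly g (w j)))\<^sup>2)"
    proof (intro sum_mono)
      fix j
      have "(cmod (poly q (w j)))\<^sup>2 \<le> (1 + e)\<^sup>2"
        using pq[OF nw] by (intro power_mono) auto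
      then show "(cmod (poly (g * q) (w j)))\<^sup>2 \<le> (1 + e)\<^sup>2 * (cmod (poly g (w j)))\<^sup>2"
        by (simp add: norm_mult power_mult_distrib mult.commute[of "(cmod (poly g (w j)))\<^sup>2"] mult_right_mono)
    qed
    also have "\<dots> = (1 + e)\<^sup>2 * (real M * (\<Sum>i<M. (cmod (coeff g i))\<^sup>2 * s ^ (2 * i)))"
      unfolding sum_distrib_left[symmetric] w_def
      by (subst parseval_roots_unity) (auto simp: M_def)
    also have "\<dots> \<le> (1 + e)\<^sup>2 * (real M * ?X)"
      using gX by (intro mult_left_mono) auto
    finally have "real M * (\<Sum>i\<le>N. ?d i * s ^ (2 * i)) \<le> real M * ((1 + e)\<^sup>2 * ?X)"
      by (simp add: mult_ac)
    then show ?thesis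
      by (simp add: M_def)
  qed
  have "(\<Sum>i\<le>N. ?d i * s ^ (2 * i)) \<le> ?X" if s: "0 < s" "s < 1" for s :: real
  proof (rule tendsto_lowerbound)
    have "((\<lambda>e. (1 + e)\<^sup>2 * ?X) \<longlongrightarrow> (1 + 0)\<^sup>2 * ?X) (at_right 0)"
      by (intro tendsto_intros)
    then show "((\<lambda>e. (1 + e)\<^sup>2 * ?X) \<longlongrightarrow> ?X) (at_right 0)" by simp
    show "\<forall>\<^sub>F e in at_right 0. (\<Sum>i\<le>N. ?d i * s ^ (2 * i)) \<le> (1 + e)\<^sup>2 * ?X"
      using eventually_at_right_less[of 0] by eventually_elim (use approx[OF s] in auto)
  qed simp
  note bound = this
  show ?thesis
  proof (rule tendsto_upperbound)
    have "((\<lambda>s. \<Sum>i\<le>N. ?d i * s ^ (2 * i)) \<longlongrightarrow> (\<Sum>i\<le>N. ?d i * 1 ^ (2 * i))) (at_left (1::real))"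
      by (intro tendsto_intros)
    then show "((\<lambda>s. \<Sum>i\<le>N. ?d i * s ^ (2 * i)) \<longlongrightarrow> (\<Sum>i\<le>N. ?d i)) (at_left (1::real))"
      by simp
    have "\<forall>\<^sub>F s in at_left (1::real). s \<in> {0<..<1}"
      by (rule eventually_at_leftI[of 0]) auto
    then show "\<forall>\<^sub>F s in at_left 1. (\<Sum>i\<le>N. ?d i * s ^ (2 * i)) \<le> ?X"
      by eventually_elim (use bound in auto)
  qed simp
qed

section \<open>Carlson's coefficient inequalities\<close>

lemma carlson_odd:
  assumes f: "f \<in> schur_class"
  shows "cmod (tcoeff f (2 * n + 1)) \<le> 1 - (\<Sum>j\<le>n. (cmod (tcoeff f j))\<^sup>2)"
proof -
  define a where "a = tcoeff f"
  define V where "V = (\<Sum>j\<le>n. (cmod (a j))\<^sup>2)"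
  have "V \<ge> 0" by (simp add: V_def sum_nonneg)
  define c where "c = a (2 * n + 1)"
  \<comment> \<open>The phase of \<open>c\<close>. Since \<open>sgn 0 = 0\<close>, the case
    \<open>c = 0\<close> is set to 1 to keep \<open>u\<close> unimodular.\<close>
  define u where "u = (if c = 0 then 1 else sgn c)"
  have u: "cmod u = 1" by (simp add: u_def norm_sgn)
  have cu: "c = u * of_real (cmod c)" by (simp add: u_def sgn_eq)
  \<comment> \<open>The entries with index above \<open>n\<close> make the last row add \<open>u V\<close> to \<open>c\<close>, while their squared norm \<open>V\<close>
    is cancelled by the first \<open>n + 1\<close> rows.\<close>
  define x where "x = (\<lambda>j. if j = 0 then 1 else if j \<le> n then 0 else cnj (a (2 * n + 1 - j)) * u)"
  define T where "T = (\<lambda>i. \<Sum>j\<le>i. x j * a (i - j))"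
  have split: "{..2 * n + 1} = insert 0 ({1..n} \<union> {n + 1..2 * n + 1})"
    by auto
  have sum_split: "(\<Sum>j\<le>2 * n + 1. h j) = h 0 + (\<Sum>j\<in>{1..n}. h j) + (\<Sum>j\<in>{n + 1..2 * n + 1}. h j)"
    for h :: "nat \<Rightarrow> 'b::comm_monoid_add"
    unfolding split by (subst sum.insert) (auto simp: sum.union_disjoint add.assoc)
  have reflect: "(\<Sum>j\<in>{n + 1..2 * n + 1}. h (2 * n + 1 - j)) = (\<Sum>j\<le>n. h j)"
    for h :: "nat \<Rightarrow> 'b::comm_monoid_add"
    by (rule sum.reindex_bij_witness[of _ "\<lambda>j. 2 * n + 1 - j" "\<lambda>j. 2 * n + 1 - j"]) auto
  have low: "T i = a i" if "i \<le> n" for i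
  proof -
    have "T i = (\<Sum>j\<in>{0}. x j * a (i - j))"
      unfolding T_def using that by (intro sum.mono_neutral_right) (auto simp: x_def)
    then show ?thesis by (simp add: x_def)
  qed
  have top: "T (2 * n + 1) = u * of_real (cmod c + V)"
  proof -
    have "T (2 * n + 1) = c + (\<Sum>j\<in>{n + 1..2 * n + 1}. cnj (a (2 * n + 1 - j)) * u * a (2 * n + 1 - j))"
      unfolding T_def sum_split by (simp add: x_def c_def)
    also have "(\<Sum>j\<in>{n + 1..2 * n + 1}. cnj (a (2 * n + 1 - j)) * u * a (2 * n + 1 - j))
        = (\<Sum>j\<le>n. cnj (a j) * u * a j)"
      by (rule reflect)
    also have "\<dots> = u * of_real V"
      by (simp add: V_def complex_norm_square sum_distrib_left mult_ac flip: of_real_power)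
    finally show ?thesis by (subst (asm) cu) (simp add: algebra_simps)
  qed
  \<comment> \<open>Rows n+1 to 2n are discarded, so the contraction reads V + (|c| + V)^2 <= 1 +
    V.\<close>
  have "V + (cmod c + V)\<^sup>2 = (\<Sum>i\<in>insert (2 * n + 1) {..n}. (cmod (T i))\<^sup>2)"
  proof -
    have "cmod (T (2 * n + 1)) = cmod c + V"
      unfolding top norm_mult norm_of_real u using \<open>V \<ge> 0\<close> by simp
    moreover have "(\<Sum>i\<in>insert (2 * n + 1) {..n}. (cmod (T i))\<^sup>2)
        = (cmod (T (2 * n + 1)))\<^sup>2 + (\<Sum>i\<le>n. (cmod (T i))\<^sup>2)"
      by (rule sum.insert) auto
    ultimately show ?thesis by (simp add: low V_def)
  qed
  also have "\<dots> \<le> (\<Sum>i\<le>2 * n + 1. (cmod (T i))\<^sup>2)"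
    by (intro sum_mono2) auto
  also have "\<dots> \<le> (\<Sum>j\<le>2 * n + 1. (cmod (x j))\<^sup>2)"
    unfolding T_def a_def by (rule toeplitz_contraction[OF f])
  also have "\<dots> = 1 + (\<Sum>j\<in>{n + 1..2 * n + 1}. (cmod (a (2 * n + 1 - j)))\<^sup>2)"
    unfolding sum_split by (simp add: x_def norm_mult u)
  also have "\<dots> = 1 + V"
    unfolding V_def by (subst reflect) simp
  finally have "(cmod c + V)\<^sup>2 \<le> 1" by simp
  then have "cmod c + V \<le> 1"
    using \<open>V \<ge> 0\<close> by (simp add: power2_le_iff_abs_le abs_square_le_1)
  then show ?thesis by (simp add: c_def V_def a_def)
qed

lemma carlson_even:
  assumes f: "f \<in> schur_class" and "n \<ge> 1"
  shows "cmod (tcoeff f (2 * n)) \<le> 1 - (\<Sum>j<n. (cmod (tcoeff f j))\<^sup>2)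
           - (cmod (tcoeff f n))\<^sup>2 / (1 + cmod (tcoeff f 0))"
proof -
  define a where "a = tcoeff f"
  define V where "V = (\<Sum>j<n. (cmod (a j))\<^sup>2)"
  have "V \<ge> 0" by (simp add: V_def sum_nonneg)
  define c where "c = a (2 * n)"
  define u where "u = (if c = 0 then 1 else sgn c)"
  have u: "cmod u = 1" by (simp add: u_def norm_sgn)
  have cu: "c = u * of_real (cmod c)" by (simp add: u_def sgn_eq)
  define \<tau> where "\<tau> = cmod (a n) / (1 + cmod (a 0))"
  have "\<tau> \<ge> 0" by (simp add: \<tau>_def)
  \<comment> \<open>The phase of \<open>t\<close> aligns \<open>t a\<^sub>n\<close> with \<open>c\<close>. Its modulus \<open>\<tau>\<close> solves \<open>\<tau> = \<bar>a\<^sub>n\<bar> - \<bar>a\<^sub>0\<bar> \<tau>\<close>, so that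
    row \<open>n\<close> makes up for the contribution \<open>\<tau>\<^sup>2\<close> to the norm of the test vector.\<close>
  define t where "t = u * cnj (a n) / of_real (1 + cmod (a 0))"
  have t: "cmod t = \<tau>"
    by (simp add: t_def \<tau>_def norm_mult norm_divide u del: of_real_add)
  have \<tau>: "\<tau> + cmod (a 0) * \<tau> = cmod (a n)"
  proof -
    have "1 + cmod (a 0) \<noteq> 0"
      using norm_ge_zero[of "a 0"] by linarith
    then have "\<tau> * (1 + cmod (a 0)) = cmod (a n)" by (simp add: \<tau>_def)
    then show ?thesis by (simp add: algebra_simps)
  qed
  define x where "x = (\<lambda>j. if j = 0 then 1 else if j < n then 0 else if j = n then t
      else cnj (a (2 * n - j)) * u)"
  define T where "T = (\<lambda>i. \<Sum>j\<le>i. x j * a (i - j))"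
  \<comment> \<open>As \<open>n \<ge> 1\<close>, the entries 1 and \<open>t\<close> of the test
    vector sit at different indices and split off separately.\<close>
  have split: "{..2 * n} = insert 0 (insert n ({1..<n} \<union> {n + 1..2 * n}))"
    by auto
  have sum_split: "(\<Sum>j\<le>2 * n. h j) = h 0 + h n + (\<Sum>j\<in>{1..<n}. h j) + (\<Sum>j\<in>{n + 1..2 * n}. h j)"
    for h :: "nat \<Rightarrow> 'b::comm_monoid_add"
  proof -
    have "sum h ({1..<n} \<union> {n + 1..2 * n}) = sum h {1..<n} + sum h {n + 1..2 * n}"
      by (rule sum.union_disjoint) auto
    then show ?thesis
      unfolding split using \<open>n \<ge> 1\<close> by (simp add: add.assoc)
  qed
  have reflect: "(\<Sum>j\<in>{n + 1..2 * n}. h (2 * n - j)) = (\<Sum>j<n. h j)"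
    for h :: "nat \<Rightarrow> 'b::comm_monoid_add"
    by (rule sum.reindex_bij_witness[of _ "\<lambda>j. 2 * n - j" "\<lambda>j. 2 * n - j"]) auto
  have low: "T i = a i" if "i < n" for i
  proof -
    have "T i = (\<Sum>j\<in>{0}. x j * a (i - j))"
      unfolding T_def using that by (intro sum.mono_neutral_right) (auto simp: x_def)
    then show ?thesis by (simp add: x_def)
  qed
  have mid: "\<tau> \<le> cmod (T n)"
  proof -
    have "T n = (\<Sum>j\<in>{0, n}. x j * a (n - j))"
      unfolding T_def by (intro sum.mono_neutral_right) (auto simp: x_def)
    also have "\<dots> = a n + t * a 0"
      using \<open>n \<ge> 1\<close> by (simp add: x_def)
    finally have "cmod (T n) \<ge> cmod (a n) - cmod (t * a 0)"
      by (metis norm_diff_ineq)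
    then show ?thesis
      using \<tau> by (simp add: norm_mult t mult.commute)
  qed
  have top: "T (2 * n) = u * of_real (cmod c + \<tau> * cmod (a n) + V)"
  proof -
    have "T (2 * n) = c + t * a n + (\<Sum>j\<in>{n + 1..2 * n}. cnj (a (2 * n - j)) * u * a (2 * n - j))"
      unfolding T_def sum_split using \<open>n \<ge> 1\<close> by (simp add: x_def c_def mult_2)
    also have "(\<Sum>j\<in>{n + 1..2 * n}. cnj (a (2 * n - j)) * u * a (2 * n - j))
        = (\<Sum>j<n. cnj (a j) * u * a j)"
      by (rule reflect)
    also have "\<dots> = u * of_real V"
      by (simp add: V_def complex_norm_square sum_distrib_left mult_ac flip: of_real_power)
    also have "t * a n = u * of_real (\<tau> * cmod (a n))"
    proof -
      have "t * a n = u * (a n * cnj (a n)) / of_real (1 + cmod (a 0))"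
        by (simp add: t_def)
      also have "a n * cnj (a n) = of_real ((cmod (a n))\<^sup>2)"
        by (simp only: complex_norm_square)
      finally show ?thesis by (simp add: \<tau>_def power2_eq_square)
    qed
    finally show ?thesis by (subst (asm) cu) (simp add: algebra_simps)
  qed
  define M where "M = cmod c + \<tau> * cmod (a n) + V"
  have "M \<ge> 0" using \<open>V \<ge> 0\<close> \<open>\<tau> \<ge> 0\<close> by (simp add: M_def)
  \<comment> \<open>The chain ends in V + \<tau>^2 + M^2 <= 1 + \<tau>^2 + V, hence
    \<open>M \<le> 1\<close>; the summand \<open>\<tau> * cmod (a n)\<close> of \<open>M\<close> is
    the quotient in the claim.\<close>
  have "V + \<tau>\<^sup>2 + M\<^sup>2 \<le> V + (cmod (T n))\<^sup>2 + M\<^sup>2"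
    using mid \<open>\<tau> \<ge> 0\<close> by (simp add: power_mono)
  also have "\<dots> = (\<Sum>i\<in>insert (2 * n) (insert n {..<n}). (cmod (T i))\<^sup>2)"
  proof -
    have "cmod (T (2 * n)) = M"
      unfolding top norm_mult norm_of_real u M_def[symmetric] using \<open>M \<ge> 0\<close> by simp
    then show ?thesis
      using \<open>n \<ge> 1\<close> by (simp add: low V_def)
  qed
  also have "\<dots> \<le> (\<Sum>i\<le>2 * n. (cmod (T i))\<^sup>2)"
    by (intro sum_mono2) auto
  also have "\<dots> \<le> (\<Sum>j\<le>2 * n. (cmod (x j))\<^sup>2)"
    unfolding T_def a_def by (rule toeplitz_contraction[OF f])
  also have "\<dots> = 1 + \<tau>\<^sup>2 + (\<Sum>j\<in>{n + 1..2 * n}. (cmod (a (2 * n - j)))\<^sup>2)"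
    unfolding sum_split using \<open>n \<ge> 1\<close> by (simp add: x_def norm_mult u t)
  also have "\<dots> = 1 + \<tau>\<^sup>2 + V"
    unfolding V_def by (subst reflect) simp
  finally have "M\<^sup>2 \<le> 1" by simp
  then have "M \<le> 1"
    using \<open>M \<ge> 0\<close> by (simp add: abs_square_le_1)
  then show ?thesis
    by (simp add: M_def c_def V_def a_def \<tau>_def power2_eq_square algebra_simps)
qed

section \<open>The bound for \<open>B1 + A0\<close>\<close>

lemma schur_abs_summable:
  assumes f: "f \<in> schur_class" and "0 \<le> \<rho>" "\<rho> < 1"
  shows "summable (\<lambda>n. cmod (tcoeff f n) * \<rho> ^ n)"
proof -
  have "ereal (norm (complex_of_real \<rho>)) < conv_radius (tcoeff f)"
    using assms(2,3) less_le_trans[OF _ schur_conv_radius[OF f], of "ereal \<rho>"]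
    by (simp add: one_ereal_def)
  from abs_summable_in_conv_radius[OF this] show ?thesis
    using assms(2) by (simp add: norm_mult norm_power)
qed

text \<open>Serves twice: it bounds the last term of \<open>bohr_sum\<close> from above, and it
  bounds \<open>B1\<close> from below in the sharpness argument.\<close>

lemma schur_diff_le_B1:
  assumes f: "f \<in> schur_class" and w: "cmod w < 1"
  shows "cmod (f w - f 0) \<le> B1 f (cmod w)"
proof -
  have "(\<lambda>n. tcoeff f (Suc n) * w ^ Suc n) sums (f w - f 0)"
    using tcoeff_sums[OF f, of w] w by (subst sums_Suc_iff) (simp add: tcoeff_0)
  moreover have "summable (\<lambda>n. norm (tcoeff f (Suc n) * w ^ Suc n))"
    using schur_abs_summable[OF f, of "cmod w"] w
    by (subst summable_Suc_iff) (simp add: norm_mult norm_power)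
  ultimately show ?thesis
    using summable_norm[of "\<lambda>n. tcoeff f (Suc n) * w ^ Suc n"]
    by (simp add: sums_iff B1_def norm_mult norm_power)
qed

lemma B1_A0_le:
  assumes f: "f \<in> schur_class" and \<rho>: "0 \<le> \<rho>" "\<rho> < 1"
  shows "B1 f \<rho> + A0 f \<rho> \<le> (1 - (cmod (f 0))\<^sup>2) * (\<rho> / (1 - \<rho>))" and "A0 f \<rho> \<ge> 0"
proof -
  define b where "b = (\<lambda>n. cmod (tcoeff f n))"
  have b0: "b n \<ge> 0" for n by (simp add: b_def)
  \<comment> \<open>This defect bounds the coefficients of index 2n+1 and 2n+2 alike, and its
    decrements are the squares occurring in \<open>A0\<close>.\<close>
  define D where "D = (\<lambda>n. 1 - (\<Sum>j\<le>n. (b j)\<^sup>2))"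
  have odd: "b (2 * n + 1) \<le> D n" for n
    using carlson_odd[OF f, of n] by (simp add: b_def D_def)
  have even: "b (2 * n + 2) \<le> D n - (b (Suc n))\<^sup>2 / (1 + b 0)" for n
    using carlson_even[OF f, of "Suc n"] by (simp add: b_def D_def lessThan_Suc_atMost)
  have D: "0 \<le> D n" "D n \<le> 1" for n
    using order_trans[OF b0 odd] by (simp_all add: D_def sum_nonneg)
  have D_Suc: "D n - D (Suc n) = (b (Suc n))\<^sup>2" for n
    by (simp add: D_def)
  define q where "q = \<rho>\<^sup>2"
  have q: "0 \<le> q" "q < 1" using \<rho> by (simp_all add: q_def power_less_one_iff)
  have pq: "\<rho> ^ (2 * n) = q ^ n" for n by (simp add: q_def power_mult)
  have sumD: "summable (\<lambda>n. D n * q ^ n)"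
    by (rule summable_comparison_test'[of "\<lambda>n. q ^ n" 0])
       (use q D in \<open>auto simp: abs_mult mult_left_le_one_le\<close>)
  define X where "X = (\<Sum>n. D n * q ^ n)"
  have X: "(\<lambda>n. D n * q ^ n) sums X"
    using sumD by (simp add: X_def summable_sums)
  \<comment> \<open>Summation by parts: the squares are differences of consecutive
    \<open>D n\<close>, so their series is the q-fold of the series \<open>X\<close> minus its
    shift, the dropped first term giving \<open>D 0\<close>.\<close>
  have Y: "(\<lambda>n. (b (Suc n))\<^sup>2 * q ^ Suc n) sums (D 0 - (1 - q) * X)"
  proof -
    have "(\<lambda>n. D (Suc n) * q ^ Suc n) sums (X - D 0)"
      using X by (subst sums_Suc_iff) simp
    from sums_diff[OF sums_mult[OF X, of q] this]
    have "(\<lambda>n. q * (D n * q ^ n) - D (Suc n) * q ^ Suc n) sums (q * X - (X - D 0))" .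
    also have "(\<lambda>n. q * (D n * q ^ n) - D (Suc n) * q ^ Suc n) = (\<lambda>n. (b (Suc n))\<^sup>2 * q ^ Suc n)"
      unfolding D_Suc[symmetric] power_Suc by (simp only: algebra_simps)
    finally show ?thesis by (simp add: algebra_simps)
  qed
  define S where "S = D 0 - (1 - q) * X"
  have A: "A0 f \<rho> = (1 / (1 + b 0) + \<rho> / (1 - \<rho>)) * S"
    unfolding A0_def pq using sums_unique[OF Y] by (simp add: b_def S_def)
  have S0: "S \<ge> 0"
    unfolding S_def by (rule sums_le[OF _ sums_zero Y]) (use q in auto)
  then show "A0 f \<rho> \<ge> 0"
    unfolding A using \<rho> b0[of 0] by simp
  have "summable (\<lambda>n. b (Suc n) * \<rho> ^ Suc n)"
    using schur_abs_summable[OF f \<rho>] by (subst summable_Suc_iff) (simp add: b_def)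
  then have "(\<lambda>n. b (Suc n) * \<rho> ^ Suc n) sums B1 f \<rho>"
    by (simp add: B1_def b_def summable_sums)
  from sums_group[OF this, of 2]
  have B: "(\<lambda>n. b (2 * n + 1) * \<rho> ^ (2 * n + 1) + b (2 * n + 2) * \<rho> ^ (2 * n + 2)) sums B1 f \<rho>"
    by (simp add: eval_nat_numeral mult.commute)
  have XS: "(\<lambda>n. \<rho> * (1 + \<rho>) * (D n * q ^ n) - 1 / (1 + b 0) * ((b (Suc n))\<^sup>2 * q ^ Suc n)) sums
      (\<rho> * (1 + \<rho>) * X - 1 / (1 + b 0) * S)"
    unfolding S_def by (intro sums_diff sums_mult X Y)
  have "b (2 * n + 1) * \<rho> ^ (2 * n + 1) + b (2 * n + 2) * \<rho> ^ (2 * n + 2)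
      \<le> \<rho> * (1 + \<rho>) * (D n * q ^ n) - 1 / (1 + b 0) * ((b (Suc n))\<^sup>2 * q ^ Suc n)" for n
  proof -
    have "b (2 * n + 1) * \<rho> ^ (2 * n + 1) + b (2 * n + 2) * \<rho> ^ (2 * n + 2)
        \<le> D n * \<rho> ^ (2 * n + 1) + (D n - (b (Suc n))\<^sup>2 / (1 + b 0)) * \<rho> ^ (2 * n + 2)"
      using \<rho> by (intro add_mono mult_right_mono odd even) auto
    also have "\<dots> = \<rho> * (1 + \<rho>) * (D n * q ^ n) - 1 / (1 + b 0) * ((b (Suc n))\<^sup>2 * q ^ Suc n)"
      by (simp add: power_add pq) (simp add: q_def algebra_simps power2_eq_square)
    finally show ?thesis .
  qed
  then have "B1 f \<rho> \<le> \<rho> * (1 + \<rho>) * X - 1 / (1 + b 0) * S"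
    by (rule sums_le[OF _ B XS])
  \<comment> \<open>By definition (1 - q) X = D 0 - S, and \<rho> (1 + \<rho>) / (1 - \<rho>^2) =
    \<rho> / (1 - \<rho>). The two negative multiples of \<open>S\<close> now present are exactly
    the two halves of \<open>A0\<close>.\<close>
  also have "\<rho> * (1 + \<rho>) * X = \<rho> / (1 - \<rho>) * (D 0 - S)"
    using \<rho> by (simp add: S_def q_def field_simps power2_eq_square)
  finally have "B1 f \<rho> + A0 f \<rho> \<le> \<rho> / (1 - \<rho>) * D 0"
    unfolding A by (simp add: algebra_simps diff_divide_distrib)
  then show "B1 f \<rho> + A0 f \<rho> \<le> (1 - (cmod (f 0))\<^sup>2) * (\<rho> / (1 - \<rho>))"
    by (simp add: D_def b_def tcoeff_0 mult.commute)
qed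

section \<open>Schwarz lemma for a zero of order n\<close>

text \<open>Shifting the power series divides out z^n and yields a quotient \<open>h\<close>
  holomorphic also at 0. The maximum principle on radius \<open>s\<close> gives |h| <= 1/s^n, and s
  tends to 1.\<close>

lemma schwarz_order:
  assumes w: "w \<in> schur_class_ord n" and z: "cmod z < 1"
  shows "cmod (w z) \<le> cmod z ^ n"
proof -
  have ws: "w \<in> schur_class" and holo: "w holomorphic_on ball 0 1"
    and le1: "\<And>z. cmod z < 1 \<Longrightarrow> cmod (w z) \<le> 1"
    using w by (auto simp: schur_class_ord_def schur_class_def)
  define F where "F = fps_expansion w 0"
  have holo': "w holomorphic_on eball 0 1" using holo by (simp add: one_ereal_def)
  have rad: "fps_conv_radius F \<ge> 1"
    unfolding F_def by (rule conv_radius_fps_expansion[OF holo'])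
  have coeff: "fps_nth F j = (deriv ^^ j) w 0 / fact j" for j
    by (simp add: F_def fps_expansion_def)
  \<comment> \<open>The zero series has \<open>subdegree\<close> 0, so the lower bound on the
    subdegree requires the nonvanishing n-th derivative.\<close>
  have "F \<noteq> 0" using w coeff[of n] by (auto simp: schur_class_ord_def)
  then have deg: "n \<le> subdegree F"
    using w by (intro subdegree_geI) (auto simp: coeff schur_class_ord_def)
  define h where "h = eval_fps (fps_shift n F)"
  have small: "ereal (cmod z) < fps_conv_radius F" if "cmod z < 1" for z
    using that rad by (metis ereal_less(3) less_le_trans)
  have wh: "w z = z ^ n * h z" if "cmod z < 1" "z \<noteq> 0" for z
    using eval_fps_shift[OF deg small[OF that(1)]] eval_fps_expansion'[OF holo', of z] that
    by (simp add: h_def F_def one_ereal_def)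
  have hol_h: "h holomorphic_on ball 0 1"
    unfolding h_def by (intro holomorphic_on_eval_fps) (use small in auto)
  have h_bound: "cmod (h z) * s ^ n \<le> 1" if s: "cmod z < s" "s < 1" for s
  proof -
    have "s > 0" using s(1) norm_ge_zero[of z] by linarith
    have "cball 0 s \<subseteq> ball (0::complex) 1" using s by auto
    then have hs: "h holomorphic_on cball 0 s"
      using hol_h by (rule holomorphic_on_subset[rotated])
    have "cmod (h z) \<le> 1 / s ^ n"
    proof (rule maximum_modulus_frontier[of h "cball 0 s"])
      show "h holomorphic_on interior (cball 0 s)"
        using hs by (rule holomorphic_on_subset) (simp add: interior_subset)
      show "continuous_on (closure (cball 0 s)) h"
        using hs by (simp add: holomorphic_on_imp_continuous_on)
      show "cmod (h y) \<le> 1 / s ^ n" if "y \<in> frontier (cball 0 s)" for y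
      proof -
        have "cmod y = s" using that by simp
        then have "y \<noteq> 0" "cmod y < 1" using \<open>s > 0\<close> \<open>s < 1\<close> by auto
        then have "cmod y ^ n * cmod (h y) \<le> 1"
          using wh[of y] le1[of y] by (simp add: norm_mult norm_power)
        then show ?thesis
          using \<open>s > 0\<close> \<open>cmod y = s\<close> by (simp add: field_simps)
      qed
    qed (use s in auto)
    then show ?thesis using \<open>s > 0\<close> by (simp add: field_simps)
  qed
  have "cmod (h z) * 1 ^ n \<le> 1"
  proof (rule tendsto_upperbound)
    show "((\<lambda>s. cmod (h z) * s ^ n) \<longlongrightarrow> cmod (h z) * 1 ^ n) (at_left (1::real))"
      by (intro tendsto_intros)
    have "\<forall>\<^sub>F s in at_left (1::real). s \<in> {cmod z<..<1}"
      by (rule eventually_at_leftI[of "cmod z"]) (use z in auto)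
    then show "\<forall>\<^sub>F s in at_left 1. cmod (h z) * s ^ n \<le> 1"
      by eventually_elim (use h_bound in auto)
  qed simp
  then have "cmod (h z) \<le> 1" by simp
  \<comment> \<open>The factorization \<open>wh\<close> excludes the origin. There \<open>w\<close>
    vanishes if n > 0, while for n = 0 the bound is 0^0 = 1.\<close>
  show ?thesis
  proof (cases "z = 0")
    case True
    then show ?thesis
      using w le1[of 0] by (cases n) (auto simp: schur_class_ord_def)
  next
    case False
    then show ?thesis
      using wh[OF z] \<open>cmod (h z) \<le> 1\<close> by (simp add: norm_mult norm_power mult_left_le)
  qed
qed

section \<open>Existence and uniqueness of the radius\<close>

lemma Psi1_strict_mono:
  assumes "k \<ge> 1" "m \<ge> 1" "0 \<le> r" "r < s" "s < 1"
  shows "Psi1 k m p r < Psi1 k m p s"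
proof -
  have "r ^ n / (1 - r ^ n) < s ^ n / (1 - s ^ n)" if "n \<ge> 1" for n
  proof -
    have "r ^ n < s ^ n" using assms that by (intro power_strict_mono) auto
    moreover have "s ^ n < 1" using assms that by (intro power_less_one_iff[THEN iffD2]) auto
    ultimately show ?thesis by (simp add: divide_simps algebra_simps)
  qed
  from this[OF assms(1)] this[OF assms(2)] show ?thesis
    by (simp add: Psi1_def)
qed

lemma Psi1_root_ex1:
  assumes "k \<ge> 1" "m \<ge> 1" "0 < p" "p \<le> 2"
  shows "\<exists>!r. r \<in> {0<..<1} \<and> Psi1 k m p r = 0"
proof -
  \<comment> \<open>Here the first fraction of \<open>Psi1\<close> is exactly 1 >= p/2, so
    \<open>Psi1\<close> is already positive while [0, s] stays away from the pole at 1.\<close>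
  define s where "s = root k (1 / 2)"
  have s: "0 < s" "s < 1" "s ^ k = 1 / 2"
    using assms(1) by (simp_all add: s_def)
  have lt1: "x ^ n < 1" if "n \<ge> 1" "x \<in> {0..s}" for x n
    using that s by (intro power_less_one_iff[THEN iffD2]) auto
  have "s ^ m / (1 - s ^ m) > 0"
    using s lt1[OF assms(2), of s] by simp
  moreover have "s ^ k / (1 - s ^ k) = 1"
    by (simp add: s(3))
  ultimately have "Psi1 k m p s > 0"
    unfolding Psi1_def using assms(4) by linarith
  moreover have neg: "Psi1 k m p 0 < 0"
    using assms by (simp add: Psi1_def power_0_left)
  moreover have "continuous_on {0..s} (Psi1 k m p)"
    unfolding Psi1_def[abs_def]
    by (intro continuous_intros) (use lt1 assms in \<open>auto, fastforce+\<close>)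
  ultimately obtain r where r: "0 \<le> r" "r \<le> s" "Psi1 k m p r = 0"
    using IVT'[of "Psi1 k m p" 0 0 s] s by auto
  have "r \<noteq> 0" using neg r(3) by auto
  show ?thesis
  proof (rule ex1I[of _ r])
    show "r \<in> {0<..<1} \<and> Psi1 k m p r = 0"
      using r \<open>r \<noteq> 0\<close> s by auto
    show "r' = r" if "r' \<in> {0<..<1} \<and> Psi1 k m p r' = 0" for r'
      using Psi1_strict_mono[OF assms(1,2), of r r' p] Psi1_strict_mono[OF assms(1,2), of r' r p]
        that r s by (cases r r' rule: linorder_cases) auto
  qed
qed

section \<open>The inequality up to the radius\<close>

text \<open>In t = a^2 the right side is the tangent at t = 1 of the concave function t^(p/2). The
  proof is weighted AM-GM for a^2 and 1 with weights p/2 and 1 - p/2.\<close>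

lemma powr_le_chord:
  fixes a p :: real
  assumes "0 \<le> a" "a \<le> 1" "0 < p" "p \<le> 2"
  shows "a powr p \<le> 1 - (1 - a\<^sup>2) * (p / 2)"
proof (cases "a = 0")
  case True
  then show ?thesis using assms by simp
next
  case False
  then have "a > 0" using assms by simp
  have "(a powr 2) powr (p / 2) * 1 powr (1 - p / 2) \<le> p / 2 * a powr 2 + (1 - p / 2) * 1"
    using assms \<open>a > 0\<close> by (intro Youngs_inequality_0) auto
  then show ?thesis
    unfolding powr_powr using \<open>a > 0\<close> by (simp add: algebra_simps)
qed

lemma divide_one_minus_mono:
  fixes \<rho> r s :: real
  assumes "0 \<le> \<rho>" "\<rho> \<le> s" "s < 1"
  shows "\<rho> / (1 - \<rho>) \<le> s / (1 - s)"
  using assms by (intro frac_le) auto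

lemma bohr_sum_le_1:
  assumes km: "k \<ge> 1" "m \<ge> 1" and p: "0 < p" "p \<le> 2"
    and f: "f \<in> schur_class" "cmod (f 0) < 1"
    and \<omega>: "\<And>n. n \<ge> 1 \<Longrightarrow> \<omega> n \<in> schur_class_ord n"
    and z: "cmod z \<le> r" and r: "r \<in> {0<..<1}" "Psi1 k m p r = 0"
  shows "bohr_sum k m p f \<omega> z \<le> 1"
proof -
  define a where "a = cmod (f 0)"
  have a: "0 \<le> a" "a < 1" "1 - a\<^sup>2 \<ge> 0"
    using f by (simp_all add: a_def power_le_one)
  have \<rho>: "cmod (\<omega> n z) \<le> r ^ n" "r ^ n < 1" if "n \<ge> 1" for n
  proof -
    have "cmod (\<omega> n z) \<le> cmod z ^ n"
      using schwarz_order[OF \<omega>[OF that]] z r by auto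
    also have "\<dots> \<le> r ^ n" using z by (intro power_mono) auto
    finally show "cmod (\<omega> n z) \<le> r ^ n" .
    show "r ^ n < 1" using r that by (intro power_less_one_iff[THEN iffD2]) auto
  qed
  have bound: "B1 f (cmod (\<omega> n z)) + A0 f (cmod (\<omega> n z)) \<le> (1 - a\<^sup>2) * (r ^ n / (1 - r ^ n))"
    if "n \<ge> 1" for n
  proof -
    have "B1 f (cmod (\<omega> n z)) + A0 f (cmod (\<omega> n z))
        \<le> (1 - a\<^sup>2) * (cmod (\<omega> n z) / (1 - cmod (\<omega> n z)))"
      unfolding a_def using \<rho>[OF that] by (intro B1_A0_le f) auto
    also have "\<dots> \<le> (1 - a\<^sup>2) * (r ^ n / (1 - r ^ n))"
      using a \<rho>[OF that] by (intro mult_left_mono divide_one_minus_mono) auto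
    finally show ?thesis .
  qed
  \<comment> \<open>Adding the nonnegative \<open>A0\<close> at \<open>\<omega> m z\<close> brings
    the last term under the same bound as the terms at \<open>\<omega> k z\<close>.\<close>
  have "cmod (f (\<omega> m z) - f 0) \<le> B1 f (cmod (\<omega> m z))"
    using \<rho>[OF km(2)] by (intro schur_diff_le_B1 f) auto
  also have "\<dots> \<le> B1 f (cmod (\<omega> m z)) + A0 f (cmod (\<omega> m z))"
    using B1_A0_le(2)[OF f(1), of "cmod (\<omega> m z)"] \<rho>[OF km(2)] by auto
  also note bound[OF km(2)]
  finally have "bohr_sum k m p f \<omega> z \<le> a powr p + (1 - a\<^sup>2) * (r ^ k / (1 - r ^ k) + r ^ m / (1 - r ^ m))"
    using bound[OF km(1)] by (simp add: bohr_sum_def tcoeff_0 a_def distrib_left)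
  also have "r ^ k / (1 - r ^ k) + r ^ m / (1 - r ^ m) = p / 2"
    using r(2) by (simp add: Psi1_def)
  also have "a powr p + (1 - a\<^sup>2) * (p / 2) \<le> 1"
    using powr_le_chord[of a p] a p by simp
  finally show ?thesis .
qed

section \<open>Sharpness of the radius\<close>

lemma power_in_schur_class_ord:
  "(\<lambda>z. z ^ n) \<in> schur_class_ord n"
proof -
  have d: "(deriv ^^ j) (\<lambda>z::complex. z ^ n) 0 = pochhammer (of_nat (Suc n - j)) j * 0 ^ (n - j)" for j
    using higher_deriv_power[of j 0 n 0] by simp
  show ?thesis
    by (auto simp: schur_class_ord_def schur_class_def d norm_power power_le_one pochhammer_fact[symmetric]
        intro!: holomorphic_intros)
qed

lemma bohr_sum_sharp:
  assumes km: "k \<ge> 1" "m \<ge> 1" and R: "R \<in> {0<..<1}" "Psi1 k m p R > 0"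
  shows "\<exists>f \<omega> z. f \<in> schur_class \<and> cmod (f 0) < 1 \<and>
           (\<forall>n\<ge>1. \<omega> n \<in> schur_class_ord n) \<and> cmod z \<le> R \<and> bohr_sum k m p f \<omega> z > 1"
proof -
  define x y where "x = R ^ k" and "y = R ^ m"
  have xy: "0 < x" "x < 1" "0 < y" "y < 1"
    using km R by (auto simp: x_def y_def power_less_one_iff)
  \<comment> \<open>The lower bound for the extremal \<open>f\<close> after dropping
    \<open>A0\<close>. Because 1 - a^2 vanishes at a = 1, only its own derivative -2 contributes
    there: H'(1) = p - 2 (x/(1-x) + y/(1-y)).\<close>
  define H where "H = (\<lambda>a. a powr p + (1 - a\<^sup>2) * (x / (1 - a * x) + y / (1 - a * y)))"
  have "(H has_real_derivative - 2 * Psi1 k m p R) (at 1)"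
    unfolding H_def Psi1_def x_def[symmetric] y_def[symmetric]
    using xy by (auto intro!: derivative_eq_intros)
  from DERIV_neg_dec_left[OF this] R(2)
  obtain d where d: "d > 0" "\<And>h. 0 < h \<Longrightarrow> h < d \<Longrightarrow> H 1 < H (1 - h)"
    by auto
  \<comment> \<open>The minimum keeps \<open>a\<close> within \<open>d\<close> of 1 and at least
    1/2.\<close>
  define a where "a = 1 - min (d / 2) (1 / 2)"
  have a: "0 < a" "a < 1" using d(1) by (auto simp: a_def)
  have "H a > 1"
    using d(2)[of "min (d / 2) (1 / 2)"] d(1) by (simp add: a_def H_def)
  define f where "f = Moebius_function 0 (of_real a)"
  have f: "f \<in> schur_class"
    unfolding schur_class_def f_def
    using a by (auto intro!: Moebius_function_holomorphic less_imp_le[OF Moebius_function_norm_lt_1])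
  have f0: "f 0 = - of_real a" by (simp add: f_def Moebius_function_simple)
  \<comment> \<open>On the positive real axis f(t) - f(0) is real and nonnegative, so its modulus
    can be computed exactly.\<close>
  have diff: "cmod (f (of_real t) - f 0) = (1 - a\<^sup>2) * (t / (1 - a * t))" if t: "0 < t" "t < 1" for t
  proof -
    have at: "a * t < 1" using mult_strict_mono[of a 1 t 1] a t by simp
    have "f (of_real t) - f 0 = of_real ((t - a) / (1 - a * t) + a)"
      by (simp add: f0 f_def Moebius_function_simple)
    also have "(t - a) / (1 - a * t) + a = (1 - a\<^sup>2) * (t / (1 - a * t))"
      using at by (simp add: field_simps power2_eq_square)
    finally show ?thesis
      using a t at by (simp add: abs_mult power_le_one del: of_real_mult of_real_divide of_real_diff)
  qed
  define \<omega> where "\<omega> = (\<lambda>n z::complex. z ^ n)"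
  have \<omega>R: "\<omega> k (of_real R) = of_real x" "\<omega> m (of_real R) = of_real y"
    by (simp_all add: \<omega>_def x_def y_def)
  have "H a \<le> a powr p + cmod (f (of_real x) - f 0) + cmod (f (of_real y) - f 0)"
    using diff[of x] diff[of y] xy by (simp add: H_def distrib_left)
  also have "\<dots> \<le> a powr p + B1 f x + A0 f x + cmod (f (of_real y) - f 0)"
    using schur_diff_le_B1[OF f, of "of_real x"] B1_A0_le(2)[OF f, of x] xy by simp
  also have "\<dots> = bohr_sum k m p f \<omega> (of_real R)"
    using a xy by (simp add: bohr_sum_def \<omega>R tcoeff_0 f0)
  finally have "bohr_sum k m p f \<omega> (of_real R) > 1"
    using \<open>H a > 1\<close> by linarith
  moreover have "cmod (f 0) < 1" "cmod (complex_of_real R) \<le> R"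
    using a R by (simp_all add: f0)
  moreover have "\<forall>n\<ge>1. \<omega> n \<in> schur_class_ord n"
    by (simp add: \<omega>_def power_in_schur_class_ord)
  ultimately show ?thesis using f by blast
qed

theorem theorem1:
  fixes k m :: nat and p :: real
  assumes "k \<ge> 1" and "m \<ge> 1" and "0 < p" and "p \<le> 2"
  shows "(\<exists>!r. r \<in> {0<..<1} \<and> Psi1 k m p r = 0) \<and>
         (\<forall>f \<omega> z. f \<in> schur_class \<and> cmod (f 0) < 1 \<and>
             (\<forall>n\<ge>1. \<omega> n \<in> schur_class_ord n) \<and> cmod z \<le> R1 k m p
             \<longrightarrow> bohr_sum k m p f \<omega> z \<le> 1) \<and>
         (\<forall>R\<in>{R1 k m p<..<1}. \<exists>f \<omega> z. f \<in> schur_class \<and> cmod (f 0) < 1 \<and>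
             (\<forall>n\<ge>1. \<omega> n \<in> schur_class_ord n) \<and> cmod z \<le> R \<and>
             bohr_sum k m p f \<omega> z > 1)"
proof (intro conjI ballI)
  note ex1 = Psi1_root_ex1[OF assms]
  then show "\<exists>!r. r \<in> {0<..<1} \<and> Psi1 k m p r = 0" .
  have R1: "R1 k m p \<in> {0<..<1}" "Psi1 k m p (R1 k m p) = 0"
    using theI'[OF ex1] by (simp_all add: R1_def)
  show "\<forall>f \<omega> z. f \<in> schur_class \<and> cmod (f 0) < 1 \<and>
             (\<forall>n\<ge>1. \<omega> n \<in> schur_class_ord n) \<and> cmod z \<le> R1 k m p
             \<longrightarrow> bohr_sum k m p f \<omega> z \<le> 1"
    using bohr_sum_le_1[OF assms _ _ _ _ R1] by blast
  fix R assume "R \<in> {R1 k m p<..<1}"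
  moreover from this have "Psi1 k m p R > 0"
    using Psi1_strict_mono[OF assms(1,2), of "R1 k m p" R p] R1 by auto
  ultimately show "\<exists>f \<omega> z. f \<in> schur_class \<and> cmod (f 0) < 1 \<and>
             (\<forall>n\<ge>1. \<omega> n \<in> schur_class_ord n) \<and> cmod z \<le> R \<and>
             bohr_sum k m p f \<omega> z > 1"
    using R1 by (intro bohr_sum_sharp assms) auto
qed

end
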